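(* Let $n$ be a positive integer such that $n+1$ is a safe prime, and let $m$ be an integer with $0<m\le n/2$. Then there exists an exceptional clique in $\mathrm{Hom}_{\mathbb{Z}}(\mathbb{Z}^m,\mathbb{Z}^n)$ of size $2^n$.
   Context: A prime $p$ is safe if $p$ is odd and $(p-1)/2$ is prime. For a commutative ring $k$ and $k$-modules $M,N$, a subset $C\subseteq \mathrm{Hom}_k(M,N)$ is an exceptional clique if for all distinct $f,g\in C$ the map $f-g$ has a left inverse, i.e. there is a $k$-linear map $h:N\to M$ with $h\circ(f-g)=\mathrm{id}_M$. *)

theory Defs
  imports "HOL-Analysis.Analysis" "HOL-Computational_Algebra.Primes"
begin

definition safe_prime :: "nat \<Rightarrow> bool" where
  "safe_prime p \<longleftrightarrow> prime p \<and> odd p \<and> prime ((p - 1) div 2)"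

text \<open>
  The modules \<open>M\<close> and \<open>N\<close> over \<open>k\<close> are whole types, given by their scalar multiplications
  \<open>sM\<close> and \<open>sN\<close>; \<open>module_hom sM sN f\<close> includes that both are modules.
\<close>
definition Hom :: "('k::comm_ring_1 \<Rightarrow> 'm::ab_group_add \<Rightarrow> 'm) \<Rightarrow>
    ('k \<Rightarrow> 'n::ab_group_add \<Rightarrow> 'n) \<Rightarrow> ('m \<Rightarrow> 'n) set" where
  "Hom sM sN = {f. module_hom sM sN f}"

definition exceptional_clique :: "('k::comm_ring_1 \<Rightarrow> 'm::ab_group_add \<Rightarrow> 'm) \<Rightarrow>
    ('k \<Rightarrow> 'n::ab_group_add \<Rightarrow> 'n) \<Rightarrow> ('m \<Rightarrow> 'n) set \<Rightarrow> bool" where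
  "exceptional_clique sM sN C \<longleftrightarrow>
     C \<subseteq> Hom sM sN \<and>
     (\<forall>f\<in>C. \<forall>g\<in>C. f \<noteq> g \<longrightarrow> (\<exists>h\<in>Hom sN sM. h \<circ> (\<lambda>x. f x - g x) = id))"

lemma module_vector_scalar_mult:
  "module ((*s) :: 'k::comm_ring_1 \<Rightarrow> 'k ^ 'i \<Rightarrow> 'k ^ 'i)"
  by unfold_locales (vector algebra_simps)+

end

theory Submission
  imports "HOL-Algebra.Algebraic_Closure_Type" Defs "HOL-Number_Theory.Pocklington"
begin

text \<open>
  A difference of integer matrices has a left inverse over the integers as soon as it is injective
  modulo every prime. Modulo a fixed prime \<open>l\<close> one finds \<open>2 ^ n\<close> matrices with injective differences:
  for \<open>l \<ge> 4\<close> greedily by counting, and for \<open>l = 2, 3\<close> as multiplications by the subset sums of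
  \<open>1, t, \<dots>, t ^ (n - 1)\<close> modulo the \<open>(n + 1)\<close>-st cyclotomic polynomial, restricted to polynomials of
  degree less than \<open>n / 2\<close>. Here the safe prime enters: the irreducible factors of that cyclotomic
  polynomial modulo \<open>2\<close> and \<open>3\<close> have degree at least \<open>n / 2\<close>. At a prime \<open>l \<ge> 2 ^ n\<close> scalar matrices
  suffice. As \<open>2 * m \<le> n\<close>, the matrices split into an upper and a lower square block. The upper
  blocks, chosen first, have nonsingular differences, so only finitely many primes remain at which
  the lower blocks matter, and the Chinese remainder theorem fits these together.
\<close>

no_notation fps_nth (infixl "$" 75)

section \<open>Congruences, determinants and left inverses over the integers\<close>

lemma chinese_remainder_primes:
  fixes u :: "nat \<Rightarrow> int"
  assumes "finite Q" "\<And>l. l \<in> Q \<Longrightarrow> prime l"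
  obtains a :: int where "\<And>l. l \<in> Q \<Longrightarrow> [a = u l] (mod int l)"
proof -
  have "\<exists>x. \<forall>l\<in>Q. [x = nat (u l mod int l)] (mod l)"
    by (rule chinese_remainder_nat[of Q "\<lambda>l. l"]) (use assms in \<open>auto intro: primes_coprime\<close>)
  then obtain x where x: "\<And>l. l \<in> Q \<Longrightarrow> [x = nat (u l mod int l)] (mod l)"
    by blast
  have "[int x = u l] (mod int l)" if "l \<in> Q" for l
  proof -
    have "l > 0" using assms(2)[OF that] by (simp add: prime_gt_0_nat)
    moreover have "[int x = int (nat (u l mod int l))] (mod int l)"
      using x[OF that] by (simp only: cong_int_iff)
    ultimately show ?thesis by simp
  qed
  then show ?thesis using that by blast
qed

lemma cong_det:
  fixes A B :: "int ^ 'm ^ 'm"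
  assumes "\<And>i j. [A $ i $ j = B $ i $ j] (mod l)"
  shows "[det A = det B] (mod l)"
  unfolding det_def by (intro cong_sum cong_mult cong_prod cong_refl assms)

lemma of_int_det:
  fixes B :: "int ^ 'm ^ 'm"
  shows "det (\<chi> i j. of_int (B $ i $ j)) = (of_int (det B) :: 'a :: comm_ring_1)"
  by (simp add: det_def)

text \<open>This is the adjugate identity. Over the rationals, Cramer's rule writes each entry of
  the inverse as a quotient by \<open>det B\<close>; after clearing this denominator the entries are
  determinants of integer matrices.\<close>

lemma det_multiple_left_inverse:
  fixes B :: "int ^ 'm ^ 'm"
  assumes "det B \<noteq> 0"
  obtains C where "C ** B = mat (det B)"
proof -
  define R :: "rat ^ 'm ^ 'm" where "R = (\<chi> i j. of_int (B $ i $ j))"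
  \<comment> \<open>The adjugate: entry \<open>(k, j)\<close> is the determinant of \<open>B\<close>
    with column \<open>k\<close> replaced by the \<open>j\<close>-th unit vector.\<close>
  define C :: "int ^ 'm ^ 'm" where
    "C = (\<chi> k j. det (\<chi> i s. if s = k then (if i = j then 1 else 0) else B $ i $ s))"
  have dR: "det R = of_int (det B)" unfolding R_def by (rule of_int_det)
  then have d0: "det R \<noteq> 0" using assms by simp
  then obtain Y where Y: "R ** Y = mat 1" "Y ** R = mat 1"
    unfolding invertible_det_nz[symmetric] invertible_def by blast
  have ent: "of_int (C $ k $ j) = det R * Y $ k $ j" for k j
  proof -
    have "R *v (\<chi> k. Y $ k $ j) = (\<chi> i. if i = j then 1 else 0)"
      using Y(1) by (simp add: vec_eq_iff matrix_matrix_mult_def matrix_vector_mult_def mat_def)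
    then have "(\<chi> k. Y $ k $ j) =
        (\<chi> k. det (\<chi> i s. if s = k then (\<chi> i. if i = j then 1 else 0) $ i else R $ i $ s) / det R)"
      using cramer[OF d0] by blast
    then have "Y $ k $ j = det (\<chi> i s. if s = k then (if i = j then 1 else 0) else R $ i $ s) / det R"
      by (simp add: vec_eq_iff cong: if_cong)
    also have "(\<chi> i s. if s = k then (if i = j then 1 else 0) else R $ i $ s) =
        (\<chi> i s. of_int ((\<chi> i s. if s = k then (if i = j then 1 else 0) else B $ i $ s) $ i $ s))"
      by (auto simp: vec_eq_iff R_def)
    also have "det \<dots> = of_int (C $ k $ j)" unfolding of_int_det by (simp add: C_def)
    finally show ?thesis using d0 by simp
  qed
  have "(C ** B) $ i $ j = mat (det B) $ i $ j" for i j
  proof -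
    have "(of_int ((C ** B) $ i $ j) :: rat) = (\<Sum>k\<in>UNIV. (det R * Y $ i $ k) * R $ k $ j)"
      unfolding ent[symmetric] by (simp add: matrix_matrix_mult_def R_def)
    also have "\<dots> = det R * (Y ** R) $ i $ j"
      by (simp add: matrix_matrix_mult_def sum_distrib_left mult.assoc)
    also have "\<dots> = of_int (mat (det B) $ i $ j)"
      by (simp add: Y mat_def dR)
    finally show ?thesis by (simp only: of_int_eq_iff)
  qed
  then have "C ** B = mat (det B)" by (simp add: vec_eq_iff)
  then show ?thesis by (rule that)
qed

lemma mat_mult_left: "(mat k ** (A :: int ^ 'm ^ 'n)) = (\<chi> i j. k * A $ i $ j)"
  by (simp add: vec_eq_iff matrix_matrix_mult_def mat_def if_distrib if_distribR sum.delta cong: if_cong)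

text \<open>The integers \<open>a\<close> for which \<open>mat a\<close> is a left multiple of \<open>D\<close> form an ideal of the
  integers, and by Cramer's rule this ideal contains every \<open>det (E ** D)\<close>.\<close>

lemma left_invertible_if_locally:
  fixes D :: "int ^ 'm ^ 'n"
  assumes loc: "\<And>l. prime l \<Longrightarrow> \<exists>E :: int ^ 'n ^ 'm. \<not> int l dvd det (E ** D)"
  shows "\<exists>E :: int ^ 'n ^ 'm. E ** D = mat 1"
proof -
  define S where "S = {a. \<exists>E :: int ^ 'n ^ 'm. E ** D = mat a}"
  have diff: "r * a + s * b \<in> S" if ab: "a \<in> S" "b \<in> S" for a b r s
  proof -
    obtain E F :: "int ^ 'n ^ 'm" where "E ** D = mat a" "F ** D = mat b"
      using ab by (auto simp: S_def)
    moreover have "(mat r ** E + mat s ** F) ** D = mat r ** (E ** D) + mat s ** (F ** D)"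
      unfolding mat_mult_left
      by (simp add: matrix_matrix_mult_def vec_eq_iff distrib_right sum.distrib sum_distrib_left mult.assoc)
    ultimately have "(mat r ** E + mat s ** F) ** D = mat (r * a + s * b)"
      by (simp add: mat_mult_left) (simp add: mat_def vec_eq_iff)
    then show ?thesis by (auto simp: S_def)
  qed
  have outside: "\<exists>a\<in>S. \<not> int l dvd a" if "prime l" for l
  proof -
    obtain E :: "int ^ 'n ^ 'm" where E: "\<not> int l dvd det (E ** D)" using loc[OF \<open>prime l\<close>] by blast
    then have "det (E ** D) \<noteq> 0" by auto
    then obtain C where "C ** (E ** D) = mat (det (E ** D))" by (rule det_multiple_left_inverse)
    then have "det (E ** D) \<in> S" by (auto simp: S_def matrix_mul_assoc)
    then show ?thesis using E by blast
  qed
  \<comment> \<open>The least positive element of the ideal; it will turn out to be 1.\<close>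
  define g where "g = (LEAST g. g > 0 \<and> int g \<in> S)"
  have "\<exists>g. g > 0 \<and> int g \<in> S"
  proof -
    obtain a where a: "a \<in> S" "\<not> 2 dvd a" using outside[of 2] by auto
    have "sgn a * a + 0 * a \<in> S" using a(1) a(1) by (rule diff)
    then have "int (nat \<bar>a\<bar>) \<in> S" by (metis abs_ge_zero abs_sgn add_0_right mult.commute mult_zero_left nat_0_le)
    moreover have "nat \<bar>a\<bar> > 0" using a(2) by auto
    ultimately show ?thesis by blast
  qed
  then have g: "g > 0" "int g \<in> S" unfolding g_def by (metis (mono_tags, lifting) LeastI_ex)+
  \<comment> \<open>Were \<open>l\<close> a prime factor of \<open>g\<close>, some \<open>b\<close>
    in \<open>S\<close> would escape \<open>l\<close>. By Bezout the gcd of \<open>g\<close> and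
    \<open>b\<close> lies in \<open>S\<close>, so minimality of \<open>g\<close> makes
    \<open>g\<close>, and with it \<open>l\<close>, divide \<open>b\<close>.\<close>
  have "g = 1"
  proof (rule ccontr)
    assume "g \<noteq> 1"
    then obtain l where l: "prime l" "l dvd g" using prime_factor_nat by blast
    obtain b where b: "b \<in> S" "\<not> int l dvd b" using outside[OF l(1)] by blast
    obtain r s where "r * int g + s * b = gcd (int g) b" using bezout_int by blast
    then have "gcd (int g) b \<in> S" using diff[OF g(2) b(1)] by metis
    then have "int (nat (gcd (int g) b)) \<in> S" by simp
    moreover have "nat (gcd (int g) b) > 0" using g(1) by simp
    ultimately have "g \<le> nat (gcd (int g) b)" unfolding g_def by (simp add: Least_le)
    moreover have "gcd (int g) b \<le> int g" using g(1) by (simp add: zdvd_imp_le)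
    ultimately have "gcd (int g) b = int g" by (simp add: le_nat_iff)
    then have "int g dvd b" by (metis gcd_dvd2)
    then show False using b(2) l(2) by (meson dvd_trans int_dvd_int_iff)
  qed
  then show ?thesis using g(2) by (simp add: S_def)
qed

section \<open>Injectivity modulo a prime\<close>

text \<open>For prime \<open>l\<close> this is full column rank over the field with \<open>l\<close>
  elements. Integer representatives keep the type independent of \<open>l\<close>, so that one
  matrix can be studied at all primes.\<close>

definition inj_mod :: "nat \<Rightarrow> ('n::finite \<Rightarrow> 'm::finite \<Rightarrow> int) \<Rightarrow> bool" where
  "inj_mod l D \<longleftrightarrow> (\<forall>v. (\<forall>i. int l dvd (\<Sum>j\<in>UNIV. D i j * v j)) \<longrightarrow> (\<forall>j. int l dvd v j))"

text \<open>Gauss elimination on the columns of \<open>D\<close>, one column at a time.\<close>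

lemma dual_vectors_mod_prime:
  fixes D :: "int ^ 'm ^ 'n" and l :: nat
  assumes l: "prime l"
    and inj: "\<And>v. (\<And>i. int l dvd (D *v v) $ i) \<Longrightarrow> (\<And>j. int l dvd v $ j)"
    and "finite J"
  shows "\<exists>e :: 'm \<Rightarrow> 'n \<Rightarrow> int. \<forall>i\<in>J. \<forall>j\<in>J.
           [(\<Sum>k\<in>UNIV. e i k * D $ k $ j) = (if i = j then 1 else 0)] (mod int l)"
  using \<open>finite J\<close>
proof (induction J)
  case empty
  show ?case by simp
next
  case (insert k J)
  define dot where "dot f s = (\<Sum>i\<in>UNIV. f i * D $ i $ s)" for f :: "'n \<Rightarrow> int" and s
  obtain e where e: "\<And>i j. i \<in> J \<Longrightarrow> j \<in> J \<Longrightarrow> [dot (e i) j = (if i = j then 1 else 0)] (mod int l)"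
    using insert.IH unfolding dot_def by blast
  \<comment> \<open>Column \<open>k\<close> minus the combination of the columns in \<open>J\<close>
    that the current dual vectors predict. If it vanished modulo \<open>l\<close>, the vector
    \<open>v\<close> below would lie in the kernel with entry 1 at \<open>k\<close>.\<close>
  define c where "c i = D $ i $ k - (\<Sum>j\<in>J. D $ i $ j * dot (e j) k)" for i
  obtain i0 where i0: "\<not> int l dvd c i0"
  proof (rule ccontr)
    assume "\<not> thesis"
    then have all: "int l dvd c i" for i using that by blast
    define v :: "int ^ 'm" where
      "v = (\<chi> j. if j = k then 1 else if j \<in> J then - dot (e j) k else 0)"
    have "(D *v v) $ i = c i" for i
    proof -
      have "(D *v v) $ i = (\<Sum>j\<in>insert k J. D $ i $ j * v $ j)"
        unfolding matrix_vector_mult_def vec_lambda_beta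
        by (rule sum.mono_neutral_right) (auto simp: v_def)
      also have "\<dots> = D $ i $ k + (\<Sum>j\<in>J. D $ i $ j * v $ j)"
        using insert.hyps by (simp add: v_def)
      also have "(\<Sum>j\<in>J. D $ i $ j * v $ j) = - (\<Sum>j\<in>J. D $ i $ j * dot (e j) k)"
        unfolding sum_negf[symmetric] using insert.hyps by (intro sum.cong) (auto simp: v_def)
      finally show ?thesis by (simp add: c_def)
    qed
    then have "int l dvd v $ k" using all inj by metis
    then show False using l by (auto simp: v_def dest: not_prime_unit)
  qed
  have "coprime (c i0) (int l)"
    using l i0 by (metis coprime_commute prime_imp_coprime prime_nat_int_transfer)
  then obtain w where w: "[c i0 * w = 1] (mod int l)" by (metis cong_solve_coprime_int)
  \<comment> \<open>Row \<open>i0\<close> of the same elimination, scaled by the inverse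
    \<open>w\<close> of \<open>c i0\<close>: modulo \<open>l\<close> it annihilates the columns in
    \<open>J\<close> and takes the value 1 on column \<open>k\<close>.\<close>
  define f where "f i = w * ((if i = i0 then 1 else 0) - (\<Sum>j\<in>J. D $ i0 $ j * e j i))" for i
  have dotf: "dot f s = w * (D $ i0 $ s - (\<Sum>j\<in>J. D $ i0 $ j * dot (e j) s))" for s
  proof -
    have "dot f s = w * (\<Sum>i\<in>UNIV. (if i = i0 then D $ i $ s else 0)
        - (\<Sum>j\<in>J. D $ i0 $ j * e j i * D $ i $ s))"
      unfolding dot_def f_def sum_distrib_left
      by (intro sum.cong) (auto simp: algebra_simps sum_distrib_left sum_distrib_right)
    also have "(\<Sum>i\<in>UNIV. (if i = i0 then D $ i $ s else 0) - (\<Sum>j\<in>J. D $ i0 $ j * e j i * D $ i $ s))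
        = D $ i0 $ s - (\<Sum>i\<in>UNIV. \<Sum>j\<in>J. D $ i0 $ j * e j i * D $ i $ s)"
      by (simp add: sum_subtractf)
    also have "(\<Sum>i\<in>UNIV. \<Sum>j\<in>J. D $ i0 $ j * e j i * D $ i $ s) = (\<Sum>j\<in>J. D $ i0 $ j * dot (e j) s)"
      unfolding dot_def by (subst sum.swap) (simp add: sum_distrib_left mult.assoc)
    finally show ?thesis .
  qed
  have fk: "[dot f k = 1] (mod int l)" using w by (simp add: dotf c_def mult.commute)
  have fJ: "[dot f s = 0] (mod int l)" if "s \<in> J" for s
  proof -
    have "[(\<Sum>j\<in>J. D $ i0 $ j * dot (e j) s) = (\<Sum>j\<in>J. D $ i0 $ j * (if j = s then 1 else 0))] (mod int l)"
      by (intro cong_sum cong_mult cong_refl e that)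
    also have "(\<Sum>j\<in>J. D $ i0 $ j * (if j = s then 1 else 0)) = D $ i0 $ s"
      using that insert.hyps by (simp add: if_distrib cong: if_cong)
    finally have "[dot f s = w * (D $ i0 $ s - D $ i0 $ s)] (mod int l)"
      unfolding dotf by (intro cong_mult cong_diff cong_refl)
    then show ?thesis by simp
  qed
  \<comment> \<open>Subtracting a multiple of \<open>f\<close> makes the old dual vectors vanish on
    column \<open>k\<close> without changing their values on \<open>J\<close> modulo
    \<open>l\<close>.\<close>
  define e' where "e' i = (if i = k then f else (\<lambda>t. e i t - dot (e i) k * f t))" for i
  have dote': "dot (e' i) s = dot (e i) s - dot (e i) k * dot f s" if "i \<noteq> k" for i s
  proof -
    have "dot (e' i) s = (\<Sum>t\<in>UNIV. e i t * D $ t $ s - dot (e i) k * (f t * D $ t $ s))"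
      unfolding dot_def[of "e' i"] using that by (simp add: e'_def algebra_simps)
    then show ?thesis
      by (simp only: sum_subtractf dot_def[of f s] dot_def[of "e i" s] sum_distrib_left)
  qed
  have "[dot (e' i) j = (if i = j then 1 else 0)] (mod int l)" if ij: "i \<in> insert k J" "j \<in> insert k J" for i j
  proof (cases "i = k")
    case True
    then show ?thesis using ij fk fJ insert.hyps by (auto simp: e'_def)
  next
    case False
    then have "i \<in> J" using ij by simp
    show ?thesis
    proof (cases "j = k")
      case True
      have "[dot (e i) k - dot (e i) k * dot f k = dot (e i) k - dot (e i) k * 1] (mod int l)"
        by (intro cong_mult cong_diff cong_refl fk)
      then show ?thesis using False True by (simp add: dote')
    next
      case jk: False
      then have "j \<in> J" using ij by simp
      have "[dot (e i) j - dot (e i) k * dot f j = (if i = j then 1 else 0) - dot (e i) k * 0] (mod int l)"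
        by (intro cong_mult cong_diff cong_refl fJ e \<open>i \<in> J\<close> \<open>j \<in> J\<close>)
      then show ?thesis using False by (simp add: dote')
    qed
  qed
  then show ?case unfolding dot_def by blast
qed

text \<open>With the dual vectors as rows of \<open>E\<close>, the product is the identity modulo
  \<open>l\<close>, so its determinant is 1 modulo \<open>l\<close>.\<close>

lemma left_multiple_det_not_dvd:
  fixes D :: "int ^ 'm ^ 'n"
  assumes l: "prime l" and inj: "inj_mod l (\<lambda>i j. D $ i $ j)"
  shows "\<exists>E :: int ^ 'n ^ 'm. \<not> int l dvd det (E ** D)"
proof -
  have "int l dvd v $ j" if "\<And>i. int l dvd (D *v v) $ i" for v j
    using inj that by (auto simp: inj_mod_def matrix_vector_mult_def)
  then obtain e where e: "\<And>i j. [(\<Sum>k\<in>UNIV. e i k * D $ k $ j) = (if i = j then 1 else 0)] (mod int l)"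
    using dual_vectors_mod_prime[where J = UNIV and D = D, OF l _ finite] by auto
  define E :: "int ^ 'n ^ 'm" where "E = (\<chi> i k. e i k)"
  have "[det (E ** D) = det (mat 1 :: int ^ 'm ^ 'm)] (mod int l)"
    by (rule cong_det) (use e in \<open>simp add: E_def matrix_matrix_mult_def mat_def\<close>)
  then have "\<not> int l dvd det (E ** D)"
    using l by (metis det_I cong_dvd_iff not_prime_unit prime_nat_int_transfer)
  then show ?thesis by blast
qed

section \<open>Greedy cliques by counting\<close>

text \<open>As \<open>v j0\<close> is invertible modulo \<open>l\<close>, the remaining coordinates
  of a solution determine coordinate \<open>j0\<close>.\<close>

lemma card_hyperplane_mod_prime:
  fixes v :: "'m::finite \<Rightarrow> int"
  assumes l: "prime l" and v: "\<not> int l dvd v j0"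
  shows "card {a \<in> UNIV \<rightarrow>\<^sub>E {0..<int l}. [(\<Sum>j\<in>UNIV. a j * v j) = c] (mod int l)} \<le> l ^ (CARD('m) - 1)"
    (is "card ?S \<le> _")
proof -
  have inj: "inj_on (\<lambda>a. restrict a (UNIV - {j0})) ?S"
  proof (rule inj_onI)
    fix a b assume a: "a \<in> ?S" and b: "b \<in> ?S" and eq: "restrict a (UNIV - {j0}) = restrict b (UNIV - {j0})"
    have ab: "a j = b j" if "j \<noteq> j0" for j
      using fun_cong[OF eq, of j] that by simp
    have "[(\<Sum>j\<in>UNIV. a j * v j) = (\<Sum>j\<in>UNIV. b j * v j)] (mod int l)"
      using a b by (auto intro: cong_trans cong_sym)
    then have "int l dvd (\<Sum>j\<in>UNIV. (a j - b j) * v j)"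
      by (simp add: cong_iff_dvd_diff left_diff_distrib sum_subtractf)
    also have "(\<Sum>j\<in>UNIV. (a j - b j) * v j) = (a j0 - b j0) * v j0"
      by (subst sum.remove[of _ j0]) (auto simp: ab)
    finally have "int l dvd a j0 - b j0"
      using l v by (simp add: prime_dvd_mult_iff)
    then have "[a j0 = b j0] (mod int l)" by (simp add: cong_iff_dvd_diff)
    moreover have "a j0 \<in> {0..<int l}" "b j0 \<in> {0..<int l}" using a b by auto
    ultimately have "a j0 = b j0" by (auto intro: cong_less_imp_eq_int)
    then show "a = b" using ab by (metis ext)
  qed
  have "(\<lambda>a. restrict a (UNIV - {j0})) ` ?S \<subseteq> (UNIV - {j0}) \<rightarrow>\<^sub>E {0..<int l}"
    by (auto intro!: restrict_PiE_iff[THEN iffD2])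
  then have "card ?S \<le> card ((UNIV - {j0}) \<rightarrow>\<^sub>E {0..<int l})"
    using inj by (intro card_inj_on_le) (auto intro: finite_PiE)
  also have "\<dots> = l ^ (CARD('m) - 1)"
    by (subst card_funcsetE) (auto simp: card_Diff_singleton)
  finally show ?thesis .
qed

text \<open>Union bound: for \<open>B\<close> in \<open>G\<close> and a nonzero vector
  \<open>v\<close> modulo \<open>l\<close>, the condition \<open>(A - B) v = 0\<close> confines
  every row of \<open>A\<close> to an affine hyperplane. This excludes at most one in
  \<open>l ^ CARD('n)\<close> of all matrices modulo \<open>l\<close>, and there are at most
  \<open>card G * l ^ CARD('m)\<close> such pairs.\<close>

lemma extend_clique_mod_prime:
  fixes G :: "('n::finite \<Rightarrow> 'm::finite \<Rightarrow> int) set"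
  assumes l: "prime l" and fin: "finite G" and small: "card G * l ^ CARD('m) < l ^ CARD('n)"
  shows "\<exists>A. \<forall>B\<in>G. inj_mod l (\<lambda>i j. A i j - B i j)"
proof -
  define W where "W = (UNIV :: 'm set) \<rightarrow>\<^sub>E {0..<int l}"
  define V where "V = {v \<in> W. \<exists>j. \<not> int l dvd v j}"
  define M where "M = (UNIV :: 'n set) \<rightarrow>\<^sub>E W"
  define R where "R v B i = {a \<in> W. [(\<Sum>j\<in>UNIV. a j * v j) = (\<Sum>j\<in>UNIV. B i j * v j)] (mod int l)}"
    for v and B :: "'n \<Rightarrow> 'm \<Rightarrow> int" and i
  define bad where "bad = (\<Union>B\<in>G. \<Union>v\<in>V. Pi\<^sub>E UNIV (R v B))"
  have lpos: "l > 0" using l by (simp add: prime_gt_0_nat)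
  have finW: "finite W" unfolding W_def by (intro finite_PiE) auto
  have cardW: "card W = l ^ CARD('m)" unfolding W_def by (subst card_funcsetE) auto
  have finV: "finite V" using finW by (simp add: V_def)
  have cardV: "card V \<le> l ^ CARD('m)"
    unfolding cardW[symmetric] by (rule card_mono) (auto simp: V_def finW)
  have cardM: "card M = (l ^ CARD('m)) ^ CARD('n)"
    unfolding M_def by (subst card_funcsetE) (auto simp: cardW)
  define c where "c = CARD('m) - 1"
  have c: "CARD('m) = Suc c" by (simp add: c_def)
  have "card bad \<le> (\<Sum>B\<in>G. \<Sum>v\<in>V. card (Pi\<^sub>E UNIV (R v B)))"
    unfolding bad_def using fin finV
    by (intro order_trans[OF card_UN_le] sum_mono card_UN_le)
  also have "\<dots> \<le> (\<Sum>B\<in>G. \<Sum>v\<in>V. (l ^ c) ^ CARD('n))"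
  proof (intro sum_mono)
    fix B v assume "v \<in> V"
    then obtain j0 where "\<not> int l dvd v j0" by (auto simp: V_def)
    then have "card (R v B i) \<le> l ^ c" for i
      unfolding R_def W_def c_def by (rule card_hyperplane_mod_prime[OF l])
    then have "(\<Prod>i\<in>(UNIV :: 'n set). card (R v B i)) \<le> (\<Prod>i\<in>(UNIV :: 'n set). l ^ c)"
      by (intro prod_mono) auto
    then show "card (Pi\<^sub>E UNIV (R v B)) \<le> (l ^ c) ^ CARD('n)"
      by (simp add: card_PiE)
  qed
  also have "\<dots> = card G * card V * (l ^ c) ^ CARD('n)" by simp
  also have "\<dots> \<le> card G * l ^ CARD('m) * (l ^ c) ^ CARD('n)"
    using cardV by simp
  also have "\<dots> < l ^ CARD('n) * (l ^ c) ^ CARD('n)"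
    using small lpos by simp
  also have "\<dots> = card M"
    by (simp only: cardM c power_mult_distrib[symmetric] power_Suc)
  finally have "card bad < card M" .
  moreover have "bad \<subseteq> M" by (auto simp: bad_def M_def R_def PiE_def Pi_def)
  ultimately obtain A where A: "A \<in> M" "A \<notin> bad"
    by (metis nat_neq_iff subset_antisym subsetI)
  have "inj_mod l (\<lambda>i j. A i j - B i j)" if B: "B \<in> G" for B
    unfolding inj_mod_def
  proof (intro allI impI, rule ccontr)
    fix v j0 assume all: "\<forall>i. int l dvd (\<Sum>j\<in>UNIV. (A i j - B i j) * v j)" and j0: "\<not> int l dvd v j0"
    \<comment> \<open>Kernel vectors are reduced to representatives in \<open>{0..<int l}\<close>,
      since \<open>bad\<close> ranges over these only.\<close>
    define w where "w j = v j mod int l" for j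
    have "w \<in> V" using lpos j0 by (auto simp: V_def W_def w_def PiE_def extensional_def dvd_eq_mod_eq_0)
    moreover have "A i \<in> R w B i" for i
    proof -
      have wv: "[(\<Sum>j\<in>UNIV. C i j * w j) = (\<Sum>j\<in>UNIV. C i j * v j)] (mod int l)" for C :: "'n \<Rightarrow> 'm \<Rightarrow> int"
        unfolding w_def by (intro cong_sum cong_mult cong_refl) (simp add: cong_def)
      have "[(\<Sum>j\<in>UNIV. A i j * v j) = (\<Sum>j\<in>UNIV. B i j * v j)] (mod int l)"
        using all by (simp add: cong_iff_dvd_diff left_diff_distrib sum_subtractf)
      then have "[(\<Sum>j\<in>UNIV. A i j * w j) = (\<Sum>j\<in>UNIV. B i j * w j)] (mod int l)"
        using wv[of A] wv[of B] by (meson cong_sym cong_trans)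
      then show ?thesis using A(1) by (auto simp: R_def M_def)
    qed
    ultimately show False using A(2) B by (auto simp: bad_def)
  qed
  then show ?thesis by blast
qed

lemma greedy_clique_mod_prime:
  assumes l: "prime l" and "N * l ^ CARD('m) \<le> l ^ CARD('n)"
  shows "\<exists>A :: nat \<Rightarrow> 'n::finite \<Rightarrow> 'm::finite \<Rightarrow> int.
    \<forall>x<N. \<forall>y<x. inj_mod l (\<lambda>i j. A x i j - A y i j)"
  using assms(2)
proof (induction N)
  case 0
  show ?case by simp
next
  case (Suc N)
  have lpos: "l > 0" using l by (simp add: prime_gt_0_nat)
  from Suc obtain A :: "nat \<Rightarrow> 'n \<Rightarrow> 'm \<Rightarrow> int"
    where A: "\<forall>x<N. \<forall>y<x. inj_mod l (\<lambda>i j. A x i j - A y i j)" by auto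
  have "card (A ` {..<N}) \<le> N" using card_image_le[of "{..<N}" A] by simp
  then have "card (A ` {..<N}) * l ^ CARD('m) \<le> N * l ^ CARD('m)" by simp
  also have "\<dots> < l ^ CARD('n)"
    using Suc.prems lpos by (simp add: less_le_trans[OF _ Suc.prems])
  finally obtain A' where "\<forall>B\<in>A ` {..<N}. inj_mod l (\<lambda>i j. A' i j - B i j)"
    using extend_clique_mod_prime[OF l, of "A ` {..<N}"] by auto
  then have "\<forall>x<Suc N. \<forall>y<x. inj_mod l (\<lambda>i j. (A(N := A')) x i j - (A(N := A')) y i j)"
    using A by (auto simp: less_Suc_eq)
  then show ?case by blast
qed

section \<open>Frobenius and roots of unity\<close>

text \<open>Frobenius is additive and fixes 1, hence fixes the image of the integers.\<close>

lemma of_int_power_CHAR: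
  assumes "prime CHAR('a :: field)"
  shows "(of_int c :: 'a) ^ CHAR('a) = of_int c"
proof -
  have nat: "(of_nat k :: 'a) ^ CHAR('a) = of_nat k" for k
    using assms by (induction k) (auto simp: freshmans_dream power_0_left)
  show ?thesis
    by (cases c rule: int_cases2) (simp_all add: nat minus_power_prime_CHAR assms)
qed

text \<open>Turns a vector indexed by a finite type into a polynomial, \<open>e\<close> assigning an
  exponent to each index. Integer coefficients make evaluation compatible with Frobenius.\<close>

definition exp_poly :: "('b::finite \<Rightarrow> nat) \<Rightarrow> ('b \<Rightarrow> int) \<Rightarrow> 'a :: field poly" where
  "exp_poly e v = (\<Sum>j\<in>UNIV. monom (of_int (v j)) (e j))"

lemma poly_exp_poly: "poly (exp_poly e v) x = (\<Sum>j\<in>UNIV. of_int (v j) * x ^ e j)"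
  by (simp add: exp_poly_def poly_sum poly_monom)

lemma coeff_exp_poly:
  assumes "inj e"
  shows "coeff (exp_poly e v) (e j) = of_int (v j)"
proof -
  have "coeff (exp_poly e v) (e j) = (\<Sum>i\<in>UNIV. if i = j then of_int (v i) else 0)"
    unfolding exp_poly_def coeff_sum coeff_monom using assms
    by (intro sum.cong) (auto simp: inj_eq)
  then show ?thesis by simp
qed

lemma degree_exp_poly_less:
  assumes "\<And>j. e j < k" "0 < k"
  shows "degree (exp_poly e v) < k"
  unfolding exp_poly_def using assms
  by (intro degree_sum_less) (auto intro: le_less_trans[OF degree_monom_le])

text \<open>Frobenius fixes the coefficients and so commutes with evaluation; in particular it maps
  roots to roots.\<close>

lemma poly_exp_poly_CHAR_power:
  assumes "prime CHAR('a :: field)"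
  shows "poly (exp_poly e v) (x ^ (CHAR('a) ^ k)) = poly (exp_poly e v) (x :: 'a) ^ (CHAR('a) ^ k)"
proof (induction k)
  case (Suc k)
  have "poly (exp_poly e v) (y ^ CHAR('a)) = poly (exp_poly e v) y ^ CHAR('a)" for y :: 'a
    by (simp add: poly_exp_poly freshmans_dream_sum assms power_mult_distrib of_int_power_CHAR
        flip: power_mult mult.commute[of "CHAR('a)"])
  then show ?case
    by (simp only: power_Suc2 power_mult Suc.IH)
qed simp

text \<open>The root is taken from \<open>1 + t + ... + t ^ (p - 1)\<close>, whose value
  \<open>p\<close> at 1 is nonzero by hypothesis.\<close>

lemma primitive_root_of_unity_exists:
  assumes p: "prime p" "(of_nat p :: 'a) \<noteq> 0"
  obtains z :: "'a :: alg_closed_field" where "z \<noteq> 1" "z ^ p = 1"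
proof -
  define P :: "'a poly" where "P = (\<Sum>a<p. monom 1 a)"
  have ev: "poly P x = (\<Sum>a<p. x ^ a)" for x by (simp add: P_def poly_sum poly_monom)
  have p2: "p \<ge> 2" using p(1) by (rule prime_ge_2_nat)
  have "coeff P (p - 1) = 1" using p2 by (simp add: P_def coeff_sum coeff_monom)
  then have "p - 1 \<le> degree P" by (intro le_degree) simp
  then have "degree P > 0" using p2 by simp
  then obtain z where z: "poly P z = 0" using alg_closed_imp_poly_has_root by blast
  have "z \<noteq> 1" using z p(2) by (auto simp: ev)
  moreover have "z ^ p = 1"
    using power_diff_1_eq[of z p] z by (simp add: ev)
  ultimately show ?thesis by (rule that)
qed

lemma power_mod_eq:
  assumes "(z :: 'a :: monoid_mult) ^ p = 1"
  shows "z ^ k = z ^ (k mod p)"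
proof -
  have "z ^ k = z ^ (p * (k div p) + k mod p)" by simp
  also have "\<dots> = z ^ (k mod p)" unfolding power_add power_mult assms by simp
  finally show ?thesis .
qed

text \<open>An order that divides the prime \<open>p\<close> and differs from 1 is \<open>p\<close>
  itself.\<close>

lemma power_eq_iff_cong_prime:
  assumes p: "prime p" and z: "(z :: 'a :: field) \<noteq> 1" "z ^ p = 1"
  shows "z ^ a = z ^ b \<longleftrightarrow> [a = b] (mod p)"
proof -
  have p0: "p > 0" using p by (simp add: prime_gt_0_nat)
  have z0: "z \<noteq> 0" using z p0 by (auto simp: power_0_left)
  have mod: "z ^ k = z ^ (k mod p)" for k using z(2) by (rule power_mod_eq)
  have one: "p dvd k" if "z ^ k = 1" for k
  proof (rule ccontr)
    assume "\<not> p dvd k"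
    then have "coprime k p" using p by (metis coprime_commute prime_imp_coprime)
    then obtain r where "[k * r = 1] (mod p)" using cong_solve_coprime_nat by auto
    then have "z ^ (k * r) = z ^ 1" by (metis mod cong_def)
    then show False using that z(1) by (simp add: power_mult)
  qed
  have le: "[a = b] (mod p)" if "z ^ a = z ^ b" "a \<le> b" for a b
  proof -
    have "z ^ a * z ^ (b - a) = z ^ b"
      unfolding power_add[symmetric] using that(2) by simp
    then have "z ^ a * z ^ (b - a) = z ^ a * 1" using that(1) by simp
    then have "z ^ (b - a) = 1" using z0 by simp
    then have "p dvd b - a" by (rule one)
    then show ?thesis using that(2) by (metis cong_altdef_nat cong_sym)
  qed
  show ?thesis
    using le[of a b] le[of b a] by (metis cong_def cong_sym mod nat_le_linear)
qed

section \<open>Multiplication modulo a cyclotomic polynomial\<close>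

text \<open>With \<open>p\<close> one more than the number of rows, the columns of this matrix are the products of the
  polynomial with coefficients \<open>c\<close> and the monomials \<open>t ^ e j\<close>, reduced modulo the
  \<open>p\<close>-th cyclotomic polynomial.\<close>

definition cyclotomic_matrix ::
    "('n::finite \<Rightarrow> nat) \<Rightarrow> ('m \<Rightarrow> nat) \<Rightarrow> ('n \<Rightarrow> int) \<Rightarrow> 'n \<Rightarrow> 'm \<Rightarrow> int" where
  "cyclotomic_matrix f e c i j = (\<Sum>k\<in>UNIV. c k *
     ((if (f k + e j) mod Suc CARD('n) = f i then 1 else 0) -
      (if (f k + e j) mod Suc CARD('n) = CARD('n) then 1 else 0)))"

text \<open>Reduction modulo \<open>1 + t + ... + t ^ n\<close>, where \<open>n = CARD('n)\<close>,
  does not change values at the roots of this polynomial. Hence on such values the matrix acts as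
  multiplication.\<close>

lemma cyclotomic_matrix_eval:
  fixes f :: "'n::finite \<Rightarrow> nat" and e :: "'m::finite \<Rightarrow> nat" and x :: "'a :: field"
  assumes f: "bij_betw f UNIV {..<CARD('n)}"
    and x: "x \<noteq> 1" "x ^ Suc CARD('n) = 1"
  shows "poly (exp_poly f (\<lambda>i. \<Sum>j\<in>UNIV. cyclotomic_matrix f e c i j * v j)) x =
    poly (exp_poly f c) x * poly (exp_poly e v) x"
proof -
  define n where "n = CARD('n)"
  define B where "B k i j = (if (f k + e j) mod Suc n = f i then 1 else 0) -
      (if (f k + e j) mod Suc n = n then 1 else 0 :: int)" for k i j
  have "(x - 1) * (\<Sum>a<Suc n. x ^ a) = 0"
    using power_diff_1_eq[of x "Suc n"] x(2) by (simp add: n_def del: power_Suc sum.lessThan_Suc)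
  \<comment> \<open>This relation rewrites \<open>x ^ n\<close> in lower powers and is the source of
    the entries -1 in \<open>B\<close>.\<close>
  then have sum0: "(\<Sum>a<n. x ^ a) = - (x ^ n)"
    using x(1) by (simp add: eq_neg_iff_add_eq_0 add.commute)
  have sumf: "(\<Sum>i\<in>UNIV. x ^ f i) = (\<Sum>a<n. x ^ a)"
    using sum.reindex_bij_betw[OF f, of "\<lambda>a. x ^ a"] by (simp add: n_def)
  have key: "(\<Sum>i\<in>UNIV. of_int (B k i j) * x ^ f i) = x ^ f k * x ^ e j" for k j
  proof -
    define r where "r = (f k + e j) mod Suc n"
    have B: "B k i j = (if r = f i then 1 else 0) - (if r = n then 1 else 0)" for i
      by (simp only: B_def r_def)
    have "x ^ (f k + e j) = x ^ r"
      unfolding r_def n_def using x(2) by (rule power_mod_eq)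
    moreover have "(\<Sum>i\<in>UNIV. of_int (B k i j) * x ^ f i) = x ^ r"
    \<comment> \<open>The exponent \<open>n\<close> is the only remainder that indexes no row;
      reducing it puts -1 in every row.\<close>
    proof (cases "r = n")
      case True
      have "f i < n" for i using f by (auto simp: n_def bij_betw_def)
      then have "(\<Sum>i\<in>UNIV. of_int (B k i j) * x ^ f i) = (\<Sum>i\<in>UNIV. - (x ^ f i))"
        unfolding B True by (intro sum.cong) (auto dest: less_imp_neq)
      then show ?thesis using True by (simp add: sum_negf sumf sum0)
    next
      case False
      then have "r < n" unfolding r_def by (meson less_SucE mod_less_divisor zero_less_Suc)
      then obtain i0 where i0: "f i0 = r" using f by (metis bij_betw_imp_surj_on imageE lessThan_iff n_def)
      have "r = f i \<longleftrightarrow> i = i0" for i using i0 f by (metis bij_betw_imp_inj_on injD)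
      then have "(\<Sum>i\<in>UNIV. of_int (B k i j) * x ^ f i) = (\<Sum>i\<in>UNIV. if i = i0 then x ^ f i else 0)"
        using False by (intro sum.cong refl) (simp add: B)
      then show ?thesis by (simp add: i0)
    qed
    ultimately show ?thesis by (simp add: power_add)
  qed
  have cm: "cyclotomic_matrix f e c i j = (\<Sum>k\<in>UNIV. c k * B k i j)" for i j
    by (simp only: cyclotomic_matrix_def B_def n_def)
  have "poly (exp_poly f (\<lambda>i. \<Sum>j\<in>UNIV. cyclotomic_matrix f e c i j * v j)) x =
      (\<Sum>i\<in>UNIV. \<Sum>j\<in>UNIV. \<Sum>k\<in>UNIV. of_int (c k) * of_int (v j) * (of_int (B k i j) * x ^ f i))"
    unfolding poly_exp_poly cm of_int_sum of_int_mult sum_distrib_right by (simp only: mult_ac)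
  also have "\<dots> = (\<Sum>j\<in>UNIV. \<Sum>k\<in>UNIV. \<Sum>i\<in>UNIV. of_int (c k) * of_int (v j) * (of_int (B k i j) * x ^ f i))"
    by (rule trans[OF sum.swap sum.cong[OF refl sum.swap]])
  also have "\<dots> = (\<Sum>j\<in>UNIV. \<Sum>k\<in>UNIV. of_int (c k) * of_int (v j) * (x ^ f k * x ^ e j))"
    by (simp only: sum_distrib_left[symmetric] key)
  also have "\<dots> = (\<Sum>k\<in>UNIV. \<Sum>j\<in>UNIV. (of_int (c k) * x ^ f k) * (of_int (v j) * x ^ e j))"
    by (rule trans[OF sum.swap]) (simp only: mult_ac)
  also have "\<dots> = poly (exp_poly f c) x * poly (exp_poly e v) x"
    by (simp add: poly_exp_poly sum_product)
  finally show ?thesis .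
qed

text \<open>A nonzero polynomial over the prime field that vanishes at a primitive \<open>p\<close>-th root of unity
  vanishes at the whole orbit of that root under Frobenius, which has at least \<open>q\<close> elements because
  the order of \<open>l\<close> modulo \<open>p\<close> divides \<open>2 * q\<close> but not \<open>2\<close>.\<close>

lemma inj_mod_cyclotomic_matrix:
  fixes f :: "'n::finite \<Rightarrow> nat" and e :: "'m::finite \<Rightarrow> nat"
  assumes f: "bij_betw f UNIV {..<CARD('n)}"
    and e: "inj e" "\<And>j. e j < q"
    and n: "CARD('n) = 2 * q" and q: "prime q" and p: "prime (Suc (2 * q))"
    and l: "prime l" "l \<noteq> Suc (2 * q)" "\<not> [l ^ 2 = 1] (mod Suc (2 * q))"
    and char: "CHAR('a :: alg_closed_field) = l"
    and c: "\<not> int l dvd c k0"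
  shows "inj_mod l (cyclotomic_matrix f e c)"
  unfolding inj_mod_def
proof (intro allI impI)
  define p where "p = Suc (2 * q)"
  note p = p[folded p_def] and l = l[folded p_def]
  have primeC: "prime CHAR('a)" using char l by simp
  fix v j0 assume v: "\<forall>i. int l dvd (\<Sum>j\<in>UNIV. cyclotomic_matrix f e c i j * v j)"
  define F :: "'a poly" where "F = exp_poly f c"
  define V :: "'a poly" where "V = exp_poly e v"
  have of_int_0: "(of_int a :: 'a) = 0 \<longleftrightarrow> int l dvd a" for a
    by (simp add: of_int_eq_0_iff_char_dvd char)
  have q0: "q > 0" using q by (simp add: prime_gt_0_nat)
  have pn: "p = Suc CARD('n)" by (simp add: p_def n)
  have prod0: "poly F x * poly V x = 0" if "x \<noteq> 1" "x ^ p = 1" for x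
  proof -
    have "poly F x * poly V x = poly (exp_poly f (\<lambda>i. \<Sum>j\<in>UNIV. cyclotomic_matrix f e c i j * v j)) x"
      unfolding F_def V_def using cyclotomic_matrix_eval[OF f that(1) that(2)[unfolded pn], of e c v] by simp
    also have "\<dots> = 0"
      unfolding poly_exp_poly using v of_int_0 by (intro sum.neutral) (metis mult_zero_left)
    finally show ?thesis .
  qed
  have "(of_nat p :: 'a) \<noteq> 0"
    using primes_dvd_imp_eq[OF l(1) p] l(2) by (auto simp: of_nat_eq_0_iff_char_dvd char)
  then obtain z :: 'a where z: "z \<noteq> 1" "z ^ p = 1" using primitive_root_of_unity_exists[OF p] by blast
  have "inj f" "\<And>i. f i < 2 * q" using f by (auto simp: bij_betw_def n)
  then have "coeff F (f k0) \<noteq> 0" using c by (simp add: F_def coeff_exp_poly of_int_0)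
  then have "F \<noteq> 0" by auto
  have degF: "degree F < 2 * q"
    unfolding F_def using \<open>\<And>i. f i < 2 * q\<close> q0 by (intro degree_exp_poly_less) auto
  \<comment> \<open>The degree of \<open>F\<close> is below \<open>2 * q\<close>, too small for
    \<open>F\<close> to vanish at all \<open>2 * q = p - 1\<close> nontrivial roots of unity. Where
    \<open>F\<close> survives, the factor \<open>V\<close> must vanish.\<close>
  have "\<exists>i\<in>{1..2 * q}. poly F (z ^ i) \<noteq> 0"
  proof (rule ccontr)
    assume "\<not> ?thesis"
    then have "(\<lambda>i. z ^ i) ` {1..2 * q} \<subseteq> {x. poly F x = 0}" by auto
    moreover have "inj_on (\<lambda>i. z ^ i) {1..2 * q}"
      by (rule inj_onI) (auto simp: power_eq_iff_cong_prime[OF p z] p_def dest: cong_less_modulus_unique_nat)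
    ultimately have "card {1..2 * q} \<le> card {x. poly F x = 0}"
      using \<open>F \<noteq> 0\<close> by (intro card_inj_on_le) (auto simp: poly_roots_finite)
    then have "2 * q \<le> card {x. poly F x = 0}" by simp
    then show False using card_poly_roots_bound[OF \<open>F \<noteq> 0\<close>] degF by linarith
  qed
  then obtain i where i: "i \<in> {1..2 * q}" "poly F (z ^ i) \<noteq> 0" by blast
  define x where "x = z ^ i"
  have x: "x \<noteq> 1" "x ^ p = 1"
  proof -
    have "\<not> [i = 0] (mod p)" using i(1) by (auto simp: cong_0_iff p_def dest: dvd_imp_le)
    then show "x \<noteq> 1" using power_eq_iff_cong_prime[OF p z, of i 0] by (simp add: x_def)
    show "x ^ p = 1" unfolding x_def using z(2) by (metis mult.commute power_mult power_one)
  qed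
  have "poly V x = 0" using prod0[OF x] i(2) by (simp add: x_def)
  then have roots: "poly V (x ^ (l ^ k)) = 0" for k
    unfolding V_def using poly_exp_poly_CHAR_power[OF primeC, of e v x k] l(1) by (simp add: char prime_gt_0_nat power_0_left)
  \<comment> \<open>The order of \<open>l\<close> would divide \<open>b - a\<close>, a positive
    number below the prime \<open>q\<close>, and so be coprime to \<open>q\<close>; as a divisor of
    \<open>p - 1 = 2 * q\<close> it would then divide 2.\<close>
  have ne: "\<not> [l ^ a = l ^ b] (mod p)" if "a < b" "b < q" for a b
  proof
    assume "[l ^ a = l ^ b] (mod p)"
    then have "[l ^ a * 1 = l ^ a * l ^ (b - a)] (mod p)" using that by (simp flip: power_add)
    moreover have cop: "coprime l p" using l p by (simp add: primes_coprime)
    ultimately have "[1 = l ^ (b - a)] (mod p)"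
      using cong_mult_lcancel_nat[of "l ^ a" p 1 "l ^ (b - a)"] by simp
    then have "ord p l dvd b - a" using ord_divides cong_sym by blast
    moreover have "ord p l dvd 2 * q"
      using euler_theorem[of l p] cop totient_prime[OF p]
      by (simp add: ord_divides[symmetric] p_def)
    moreover have "coprime (ord p l) q"
    proof -
      have "\<not> q dvd b - a" using that by (auto dest: dvd_imp_le)
      then have "coprime (b - a) q" using prime_imp_coprime[OF q] coprime_commute by blast
      then show ?thesis
        using coprime_divisors[OF \<open>ord p l dvd b - a\<close> dvd_refl[of q]] by simp
    qed
    ultimately have "ord p l dvd 2"
      using coprime_dvd_mult_left_iff[of "ord p l" q 2] by simp
    then show False using l(3) ord_divides by blast
  qed
  have "V = 0"
  proof (rule ccontr)
    assume "V \<noteq> 0"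
    \<comment> \<open>The first \<open>q\<close> Frobenius conjugates of \<open>x\<close> are
      distinct, which is too many roots for the degree of \<open>V\<close>.\<close>
    have "inj_on (\<lambda>k. x ^ (l ^ k)) {..<q}"
    proof (rule linorder_inj_onI')
      fix a b assume "a \<in> {..<q}" "b \<in> {..<q}" "a < b"
      then show "x ^ (l ^ a) \<noteq> x ^ (l ^ b)" using ne by (auto simp: power_eq_iff_cong_prime[OF p x])
    qed
    then have "q = card ((\<lambda>k. x ^ (l ^ k)) ` {..<q})" by (simp add: card_image)
    also have "\<dots> \<le> card {y. poly V y = 0}"
      using roots \<open>V \<noteq> 0\<close> by (intro card_mono) (auto simp: poly_roots_finite)
    also have "\<dots> \<le> degree V" using \<open>V \<noteq> 0\<close> by (rule card_poly_roots_bound)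
    also have "\<dots> < q" unfolding V_def using e q0 by (intro degree_exp_poly_less) auto
    finally show False by simp
  qed
  moreover have "coeff V (e j0) = of_int (v j0)" unfolding V_def by (rule coeff_exp_poly[OF e(1)])
  ultimately show "int l dvd v j0" by (metis of_int_0 coeff_0)
qed

section \<open>Cliques modulo every prime\<close>

text \<open>The algebraic closures of this field and of \<open>Enum.finite_3\<close> supply the
  fields of characteristic 2 and 3 in which roots of unity are taken.\<close>

lemma CHAR_finite_2: "CHAR(Enum.finite_2) = 2"
proof -
  have "(2 :: Enum.finite_2) = 0" by (simp only: numeral.simps) (simp add: plus_finite_2_def one_finite_2_def zero_finite_2_def)
  then have "CHAR(Enum.finite_2) dvd 2" by (simp flip: of_nat_eq_0_iff_char_dvd)
  moreover from this have "prime CHAR(Enum.finite_2)" by (intro prime_CHAR_semidom) (auto intro: Nat.gr0I)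
  ultimately show ?thesis by (simp add: primes_dvd_imp_eq)
qed

lemma CHAR_finite_3: "CHAR(Enum.finite_3) = 3"
proof -
  have "(3 :: Enum.finite_3) = 0"
    by (simp only: numeral.simps) (simp add: plus_finite_3_def one_finite_3_def zero_finite_3_def)
  then have "CHAR(Enum.finite_3) dvd 3" by (simp flip: of_nat_eq_0_iff_char_dvd)
  moreover from this have "prime CHAR(Enum.finite_3)" by (intro prime_CHAR_semidom) (auto intro: Nat.gr0I)
  ultimately show ?thesis by (simp add: primes_dvd_imp_eq)
qed

lemma inj_mod_cong:
  assumes "inj_mod l D" and eq: "\<And>i j. [D i j = D' i j] (mod int l)"
  shows "inj_mod l D'"
  unfolding inj_mod_def
proof (intro allI impI)
  fix v j assume v: "\<forall>i. int l dvd (\<Sum>j\<in>UNIV. D' i j * v j)"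
  have "[(\<Sum>j\<in>UNIV. D i j * v j) = (\<Sum>j\<in>UNIV. D' i j * v j)] (mod int l)" for i
    by (intro cong_sum cong_mult cong_refl eq)
  then have "\<forall>i. int l dvd (\<Sum>j\<in>UNIV. D i j * v j)"
    using v cong_dvd_iff by blast
  then show "int l dvd v j" using assms(1) by (auto simp: inj_mod_def)
qed

lemma inj_mod_diff_commute:
  assumes "inj_mod l (\<lambda>i j. A i j - B i j)"
  shows "inj_mod l (\<lambda>i j. B i j - A i j)"
proof -
  have "(\<Sum>j\<in>UNIV. (B i j - A i j) * v j) = - (\<Sum>j\<in>UNIV. (A i j - B i j) * v j)" for i v
    by (simp add: left_diff_distrib sum_subtractf)
  then show ?thesis using assms by (simp add: inj_mod_def)
qed

definition clique_mod :: "nat \<Rightarrow> nat \<Rightarrow> (nat \<Rightarrow> 'n::finite \<Rightarrow> 'm::finite \<Rightarrow> int) \<Rightarrow> bool" where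
  "clique_mod l N A \<longleftrightarrow> (\<forall>x<N. \<forall>y<N. x \<noteq> y \<longrightarrow> inj_mod l (\<lambda>i j. A x i j - A y i j))"

lemma clique_modI:
  assumes "\<And>x y. x < N \<Longrightarrow> y < x \<Longrightarrow> inj_mod l (\<lambda>i j. A x i j - A y i j)"
  shows "clique_mod l N A"
  unfolding clique_mod_def
proof (intro allI impI)
  fix x y assume "x < N" "y < N" "x \<noteq> y"
  then consider "y < x" | "x < y" by linarith
  then show "inj_mod l (\<lambda>i j. A x i j - A y i j)"
  proof cases
    case 1
    then show ?thesis using assms \<open>x < N\<close> by simp
  next
    case 2
    then show ?thesis using assms[OF \<open>y < N\<close>, of x] by (intro inj_mod_diff_commute[of l "A y" "A x"])
  qed
qed

lemma cyclotomic_matrix_diff: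
  "cyclotomic_matrix f e c i j - cyclotomic_matrix f e d i j =
   cyclotomic_matrix f e (\<lambda>k. c k - d k) i j"
  by (simp add: cyclotomic_matrix_def sum_subtractf left_diff_distrib)

text \<open>Members are indexed by sets of rows through 0/1 coefficient vectors. The construction is
  linear in the coefficients, and distinct vectors differ by 1 or -1 somewhere, which is nonzero
  modulo every prime.\<close>

lemma cyclotomic_clique_mod:
  assumes q: "prime q" and p: "prime (Suc (2 * q))"
    and n: "CARD('n::finite) = 2 * q" and m: "CARD('m::finite) \<le> q"
    and l: "prime l" "l \<noteq> Suc (2 * q)" "\<not> [l ^ 2 = 1] (mod Suc (2 * q))"
    and char: "CHAR('a :: alg_closed_field) = l"
  shows "\<exists>A :: nat \<Rightarrow> 'n \<Rightarrow> 'm \<Rightarrow> int. clique_mod l (2 ^ CARD('n)) A"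
proof -
  obtain f :: "'n \<Rightarrow> nat" where f: "bij_betw f UNIV {..<CARD('n)}"
    using ex_bij_betw_finite_nat[of "UNIV :: 'n set"] by (auto simp: atLeast0LessThan)
  obtain e :: "'m \<Rightarrow> nat" where e: "bij_betw e UNIV {..<CARD('m)}"
    using ex_bij_betw_finite_nat[of "UNIV :: 'm set"] by (auto simp: atLeast0LessThan)
  obtain g :: "nat \<Rightarrow> 'n set" where g: "bij_betw g {0..<card (UNIV :: 'n set set)} UNIV"
    using ex_bij_betw_nat_finite[of "UNIV :: 'n set set"] by auto
  have "inj_on g {..<2 ^ CARD('n)}"
    using g by (simp add: bij_betw_def atLeast0LessThan card_UNIV_set)
  moreover have "inj e" "\<And>j. e j < q"
    using e m by (auto simp: bij_betw_def intro: less_le_trans)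
  moreover define A where "A x = cyclotomic_matrix f e (\<lambda>k. if k \<in> g x then 1 else 0)" for x
  ultimately have "inj_mod l (\<lambda>i j. A x i j - A y i j)"
    if "x < 2 ^ CARD('n)" "y < 2 ^ CARD('n)" "x \<noteq> y" for x y
  proof -
    have "g x \<noteq> g y" using that \<open>inj_on g _\<close> by (auto dest: inj_onD)
    then obtain k where "k \<in> g x \<longleftrightarrow> k \<notin> g y" by (auto simp: set_eq_iff)
    then have "\<not> int l dvd (if k \<in> g x then 1 else 0) - (if k \<in> g y then 1 else 0)"
      using l(1) by (auto dest: not_prime_unit)
    then show ?thesis
      unfolding A_def cyclotomic_matrix_diff
      by (rule inj_mod_cyclotomic_matrix[OF f \<open>inj e\<close> \<open>\<And>j. e j < q\<close> n q p l char])
  qed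
  then show ?thesis by (auto simp: clique_mod_def)
qed

lemma clique_mod_prime_exists:
  assumes q: "prime q" and p: "prime (Suc (2 * q))"
    and n: "CARD('n::finite) = 2 * q" and m: "CARD('m::finite) \<le> q" and l: "prime l"
  shows "\<exists>A :: nat \<Rightarrow> 'n \<Rightarrow> 'm \<Rightarrow> int. clique_mod l (2 ^ CARD('n)) A"
proof -
  have q2: "q \<ge> 2" using q by (rule prime_ge_2_nat)
  consider "l = 2" | "l = 3" | "l \<ge> 4" using prime_ge_2_nat[OF l] by linarith
  then show ?thesis
  proof cases
    case 1
    \<comment> \<open>\<open>Suc (2 * q)\<close> is at least 5, so \<open>2 ^ 2\<close> is not 1
      modulo it.\<close>
    have "\<not> [4 = 1] (mod Suc (2 * q))" using q2 by (auto simp: cong_def)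
    then show ?thesis
      using 1 q2 CHAR_finite_2
      by (intro cyclotomic_clique_mod[OF q p n m l, where ?'a = "Enum.finite_2 alg_closure"]) auto
  next
    case 2
    \<comment> \<open>If \<open>3 ^ 2\<close> were 1, the prime \<open>Suc (2 * q)\<close> would
      divide 8 and hence 2.\<close>
    have "Suc (2 * q) dvd 8 \<Longrightarrow> False"
    proof -
      assume "Suc (2 * q) dvd 8"
      then have "Suc (2 * q) dvd 2 ^ 3" by simp
      then have "Suc (2 * q) dvd 2" using p prime_dvd_power by blast
      then show False using q2 by (auto dest: dvd_imp_le)
    qed
    then have "\<not> [9 = 1] (mod Suc (2 * q))"
      using cong_altdef_nat[of 1 9 "Suc (2 * q)"] by auto
    then show ?thesis
      using 2 q2 CHAR_finite_3
      by (intro cyclotomic_clique_mod[OF q p n m l, where ?'a = "Enum.finite_3 alg_closure"]) auto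
  next
    case 3
    \<comment> \<open>Here \<open>l \<ge> 4\<close> absorbs the clique size
      \<open>2 ^ n = 4 ^ q\<close> into the factor \<open>l ^ q\<close> that at most
      \<open>q\<close> columns leave free.\<close>
    have "2 ^ CARD('n) * l ^ CARD('m) \<le> 4 ^ q * l ^ q"
      using m 3 by (auto simp: n power_mult intro: power_increasing)
    also have "\<dots> \<le> l ^ q * l ^ q" using 3 by (simp add: power_mono)
    also have "\<dots> = l ^ CARD('n)" by (simp add: n mult_2 power_add)
    finally have "2 ^ CARD('n) * l ^ CARD('m) \<le> l ^ CARD('n)" .
    from greedy_clique_mod_prime[OF l this] obtain A :: "nat \<Rightarrow> 'n \<Rightarrow> 'm \<Rightarrow> int"
      where "\<forall>x<2 ^ CARD('n). \<forall>y<x. inj_mod l (\<lambda>i j. A x i j - A y i j)" ..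
    then have "clique_mod l (2 ^ CARD('n)) A" by (simp add: clique_modI)
    then show ?thesis by blast
  qed
qed

section \<open>Gluing the local cliques\<close>

lemma chinese_remainder_family:
  fixes u :: "nat \<Rightarrow> 'b \<Rightarrow> int"
  assumes "finite Q" "\<And>l. l \<in> Q \<Longrightarrow> prime l"
  shows "\<exists>a. \<forall>b. \<forall>l\<in>Q. [a b = u l b] (mod int l)"
proof (rule choice, rule allI)
  fix b
  obtain a where "\<And>l. l \<in> Q \<Longrightarrow> [a = u l b] (mod int l)"
    using chinese_remainder_primes[OF assms, of "\<lambda>l. u l b"] by blast
  then show "\<exists>a. \<forall>l\<in>Q. [a = u l b] (mod int l)" by blast
qed

lemma det_mat: "det (mat k :: int ^ 'm ^ 'm) = k ^ CARD('m)"
  by (subst det_diagonal) (simp_all add: mat_def)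

lemma not_dvd_diff_if_less:
  assumes "x < l" "y < l" "x \<noteq> y"
  shows "\<not> int l dvd int x - int y"
proof
  assume "int l dvd int x - int y"
  then have "[int x = int y] (mod int l)" by (simp add: cong_iff_dvd_diff)
  then have "[x = y] (mod l)" by (simp only: cong_int_iff)
  then show False using assms cong_less_modulus_unique_nat by blast
qed

lemma integral_clique_of_local:
  assumes card: "2 * CARD('m::finite) \<le> CARD('n::finite)"
    and loc: "\<And>l. prime l \<Longrightarrow> \<exists>F :: nat \<Rightarrow> 'n \<Rightarrow> 'm \<Rightarrow> int. clique_mod l N F"
  shows "\<exists>A :: nat \<Rightarrow> int ^ 'm ^ 'n. \<forall>x<N. \<forall>y<N. x \<noteq> y \<longrightarrow>
           (\<exists>E :: int ^ 'n ^ 'm. E ** (A x - A y) = mat 1)"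
proof -
  obtain F :: "nat \<Rightarrow> nat \<Rightarrow> 'n \<Rightarrow> 'm \<Rightarrow> int" where F: "\<And>l. prime l \<Longrightarrow> clique_mod l N (F l)"
    using loc by metis
  \<comment> \<open>Two copies of the column index embed in the rows: \<open>s\<close> selects the
    upper block and \<open>t\<close> a disjoint lower block.\<close>
  have "\<exists>h :: 'm + 'm \<Rightarrow> 'n. inj h"
    using card inj_on_iff_card_le[of "UNIV :: ('m + 'm) set" "UNIV :: 'n set"] by (auto simp: card_UNIV_sum)
  then obtain h :: "'m + 'm \<Rightarrow> 'n" where h: "inj h" by blast
  define s t where "s = (\<lambda>j. h (Inl j))" and "t = (\<lambda>j. h (Inr j))"
  have s: "inj s" and t: "\<And>j k. t j = t k \<longleftrightarrow> j = k" and st: "\<And>j. t j \<notin> range s"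
    using h by (auto simp: s_def t_def inj_def)
  \<comment> \<open>At this auxiliary prime the upper blocks will be scalar matrices
    \<open>x\<close>, whose differences stay nonsingular since
    \<open>0 < |x - y| < r\<close>.\<close>
  obtain r where r: "prime r" "r > N" using bigger_prime by blast
  define P where "P = {l. prime l \<and> l < N}"
  have finP: "finite P" by (rule finite_subset[of _ "{..<N}"]) (auto simp: P_def)
  have prime_rP: "prime l" if "l \<in> insert r P" for l using that r by (auto simp: P_def)
  \<comment> \<open>Upper blocks: rows of the local cliques at primes below \<open>N\<close>, scalar
    matrices at \<open>r\<close>.\<close>
  obtain T :: "nat \<times> 'm \<times> 'm \<Rightarrow> int" where T: "\<And>l b. l \<in> insert r P \<Longrightarrow>
      [T b = (case b of (x, j, k) \<Rightarrow> if l < N then F l x (s j) k else if j = k then int x else 0)] (mod int l)"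
    using chinese_remainder_family[where Q = "insert r P" and u = "\<lambda>l b. case b of (x, j, k) \<Rightarrow>
        if l < N then F l x (s j) k else if j = k then int x else 0"] finP prime_rP by blast
  define M :: "nat \<Rightarrow> nat \<Rightarrow> int ^ 'm ^ 'm" where "M x y = (\<chi> j k. T (x, j, k) - T (y, j, k))" for x y
  have detM: "det (M x y) \<noteq> 0" if xy: "x < N" "y < N" "x \<noteq> y" for x y
  proof -
    have "[M x y $ j $ k = mat (int x - int y) $ j $ k] (mod int r)" for j k
    proof -
      have "[M x y $ j $ k = (if j = k then int x else 0) - (if j = k then int y else 0)] (mod int r)"
        unfolding M_def vec_lambda_beta
        using T[of r "(x, j, k)"] T[of r "(y, j, k)"] r(2) by (intro cong_diff) auto
      also have "(if j = k then int x else 0) - (if j = k then int y else 0) = mat (int x - int y) $ j $ k"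
        by (simp add: mat_def)
      finally show ?thesis .
    qed
    then have "[det (M x y) = det (mat (int x - int y) :: int ^ 'm ^ 'm)] (mod int r)"
      by (rule cong_det)
    then have "[det (M x y) = (int x - int y) ^ CARD('m)] (mod int r)"
      by (simp only: det_mat)
    moreover have "\<not> int r dvd (int x - int y) ^ CARD('m)"
    proof
      assume "int r dvd (int x - int y) ^ CARD('m)"
      then have "int r dvd int x - int y" using r(1) prime_dvd_power by (metis prime_nat_int_transfer)
      then show False using not_dvd_diff_if_less[of x r y] xy r(2) by simp
    qed
    ultimately have "\<not> int r dvd det (M x y)" using cong_dvd_iff by blast
    then show ?thesis by auto
  qed
  \<comment> \<open>Outside this finite set the upper blocks alone give injectivity, so the
    remaining rows need to be prescribed only at primes in \<open>Q\<close>.\<close>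
  define Q where "Q = P \<union> (\<Union>x<N. \<Union>y\<in>{..<N} - {x}. {l. prime l \<and> int l dvd det (M x y)})"
  have "finite {l. prime l \<and> int l dvd d}" if "d \<noteq> 0" for d
  proof (rule finite_subset)
    show "{l. prime l \<and> int l dvd d} \<subseteq> {..nat \<bar>d\<bar>}"
    proof
      fix l assume "l \<in> {l. prime l \<and> int l dvd d}"
      then have "int l \<le> \<bar>d\<bar>" using dvd_imp_le_int[OF that, of "int l"] by simp
      then show "l \<in> {..nat \<bar>d\<bar>}" by (simp add: le_nat_iff)
    qed
  qed simp
  then have "finite (\<Union>x<N. \<Union>y\<in>{..<N} - {x}. {l. prime l \<and> int l dvd det (M x y)})"
    using detM by (intro finite_UN_I) auto
  then have finQ: "finite Q" unfolding Q_def using finP by simp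
  have primeQ: "prime l" if "l \<in> Q" for l using that by (auto simp: Q_def P_def)
  \<comment> \<open>Remaining rows: those of the local cliques at primes below \<open>N\<close>; at
    the larger primes of \<open>Q\<close>, the scalar \<open>x\<close> on the lower block and zero
    elsewhere.\<close>
  obtain U :: "nat \<times> 'n \<times> 'm \<Rightarrow> int" where U: "\<And>l b. l \<in> Q \<Longrightarrow>
      [U b = (case b of (x, i, k) \<Rightarrow> if l < N then F l x i k else if i = t k then int x else 0)] (mod int l)"
    using chinese_remainder_family[where Q = Q and u = "\<lambda>l b. case b of (x, i, k) \<Rightarrow>
        if l < N then F l x i k else if i = t k then int x else 0"] finQ primeQ by blast
  define A :: "nat \<Rightarrow> int ^ 'm ^ 'n" where
    "A x = (\<chi> i k. if i \<in> range s then T (x, inv_into UNIV s i, k) else U (x, i, k))" for x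
  have "\<exists>E :: int ^ 'n ^ 'm. E ** (A x - A y) = mat 1" if xy: "x < N" "y < N" "x \<noteq> y" for x y
  proof (rule left_invertible_if_locally)
    fix l :: nat assume l: "prime l"
    \<comment> \<open>Below \<open>N\<close> the matrices agree with the local clique. At larger
      primes in \<open>Q\<close> the lower block of the difference is the scalar
      \<open>x - y\<close>, nonzero modulo \<open>l\<close>. Outside \<open>Q\<close> the upper
      block is nonsingular modulo \<open>l\<close>.\<close>
    consider "l \<in> Q" "l < N" | "l \<in> Q" "l \<ge> N" | "l \<notin> Q" by linarith
    then show "\<exists>E :: int ^ 'n ^ 'm. \<not> int l dvd det (E ** (A x - A y))"
    proof cases
      case 1
      have A: "[A z $ i $ k = F l z i k] (mod int l)" for z i k
      proof (cases "i \<in> range s")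
        case True
        have "l \<in> insert r P" using 1 l by (simp add: P_def)
        then show ?thesis using T[of l "(z, inv_into UNIV s i, k)"] 1 True by (simp add: A_def f_inv_into_f)
      next
        case False
        then show ?thesis using U[of l "(z, i, k)"] 1 by (simp add: A_def)
      qed
      have "inj_mod l (\<lambda>i j. F l x i j - F l y i j)"
        using F[OF l] xy by (simp add: clique_mod_def)
      then have "inj_mod l (\<lambda>i j. (A x - A y) $ i $ j)"
        by (rule inj_mod_cong) (simp, intro cong_diff cong_sym[OF A])
      then show ?thesis by (rule left_multiple_det_not_dvd[OF l])
    next
      case 2
      have "[(A x - A y) $ t k $ j = (if k = j then int x - int y else 0)] (mod int l)" for j k
      proof -
        have "[U (x, t k, j) - U (y, t k, j) =
            (if t k = t j then int x else 0) - (if t k = t j then int y else 0)] (mod int l)"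
          using U[of l "(x, t k, j)"] U[of l "(y, t k, j)"] 2 by (intro cong_diff) auto
        then show ?thesis using st by (auto simp: A_def t)
      qed
      note bot = this
      have "inj_mod l (\<lambda>i j. (A x - A y) $ i $ j)"
        unfolding inj_mod_def
      proof (intro allI impI)
        fix v k assume v: "\<forall>i. int l dvd (\<Sum>j\<in>UNIV. (A x - A y) $ i $ j * v j)"
        have "[(\<Sum>j\<in>UNIV. (A x - A y) $ t k $ j * v j) =
            (\<Sum>j\<in>UNIV. (if k = j then int x - int y else 0) * v j)] (mod int l)"
          by (intro cong_sum cong_mult cong_refl bot)
        also have "(\<Sum>j\<in>UNIV. (if k = j then int x - int y else 0) * v j) = (int x - int y) * v k"
          by (simp add: if_distrib[of "\<lambda>z. z * _"] cong: if_cong)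
        finally have "int l dvd (int x - int y) * v k" using v cong_dvd_iff by blast
        moreover have "\<not> int l dvd int x - int y" using not_dvd_diff_if_less xy 2 by simp
        ultimately show "int l dvd v k" using l by (simp add: prime_dvd_mult_iff)
      qed
      then show ?thesis by (rule left_multiple_det_not_dvd[OF l])
    next
      case 3
      define E :: "int ^ 'n ^ 'm" where "E = (\<chi> k i. if i = s k then 1 else 0)"
      have "E ** (A x - A y) = M x y"
      proof -
        have "(E ** (A x - A y)) $ k $ j = (\<Sum>i\<in>UNIV. if i = s k then (A x - A y) $ i $ j else 0)" for j k
          unfolding matrix_matrix_mult_def E_def vec_lambda_beta by (intro sum.cong) auto
        then show ?thesis using s by (simp add: vec_eq_iff A_def M_def)
      qed
      then have "\<not> int l dvd det (E ** (A x - A y))" using 3 l xy by (auto simp: Q_def)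
      then show ?thesis by blast
    qed
  qed
  then show ?thesis by blast
qed

section \<open>From matrices to homomorphisms\<close>

lemma matrix_vector_mult_Hom: "(*v) (A :: int ^ 'm ^ 'n) \<in> Hom (*s) (*s)"
  unfolding Hom_def mem_Collect_eq
  by (intro module_hom.intro module_hom_axioms.intro module_vector_scalar_mult)
    (simp_all add: matrix_vector_mult_def vec_eq_iff sum.distrib sum_distrib_left algebra_simps)

lemma exceptional_clique_of_matrices:
  fixes A :: "nat \<Rightarrow> int ^ 'm ^ 'n"
  assumes A: "\<And>x y. x < N \<Longrightarrow> y < N \<Longrightarrow> x \<noteq> y \<Longrightarrow> \<exists>E :: int ^ 'n ^ 'm. E ** (A x - A y) = mat 1"
  shows "exceptional_clique (*s) (*s) ((\<lambda>x. (*v) (A x)) ` {..<N})"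
    and "card ((\<lambda>x. (*v) (A x)) ` {..<N}) = N"
proof -
  have inv: "\<exists>h\<in>Hom (*s) (*s). h \<circ> (\<lambda>v. A x *v v - A y *v v) = id"
    if xy: "x < N" "y < N" "x \<noteq> y" for x y
  proof -
    obtain E :: "int ^ 'n ^ 'm" where "E ** (A x - A y) = mat 1" using A[OF xy] by blast
    then have "(*v) E \<circ> (\<lambda>v. A x *v v - A y *v v) = id"
      by (simp add: fun_eq_iff matrix_vector_mul_assoc flip: matrix_vector_mult_diff_rdistrib)
    then show ?thesis using matrix_vector_mult_Hom by blast
  qed
  show "exceptional_clique (*s) (*s) ((\<lambda>x. (*v) (A x)) ` {..<N})"
    unfolding exceptional_clique_def using inv matrix_vector_mult_Hom by auto
  have "inj_on (\<lambda>x. (*v) (A x)) {..<N}"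
  \<comment> \<open>Equal maps have difference zero, and a left inverse of zero would send 0 to
    every vector, although the module is nonzero.\<close>
  proof (rule inj_onI, rule ccontr)
    fix x y assume xy: "x \<in> {..<N}" "y \<in> {..<N}" "(*v) (A x) = (*v) (A y)" "x \<noteq> y"
    then obtain h where "h \<circ> (\<lambda>v. A x *v v - A y *v v) = id" using inv[of x y] by blast
    then have "h (A x *v v - A y *v v) = v" for v by (metis comp_apply id_apply)
    then have "h 0 = v" for v using xy(3) by simp
    then have "(0 :: int ^ 'm) = 1" by metis
    then show False by simp
  qed
  then show "card ((\<lambda>x. (*v) (A x)) ` {..<N}) = N" by (simp add: card_image)
qed

theorem theorem12p6:
  fixes n m :: nat
  assumes "n > 0"
    and "safe_prime (n + 1)"
    and "0 < m"
    and "real m \<le> real n / 2"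
    and "CARD('m::finite) = m"
    and "CARD('n::finite) = n"
  shows "\<exists>C :: (int ^ 'm \<Rightarrow> int ^ 'n) set.
    exceptional_clique ((*s) :: int \<Rightarrow> int ^ 'm \<Rightarrow> int ^ 'm) ((*s) :: int \<Rightarrow> int ^ 'n \<Rightarrow> int ^ 'n) C
    \<and> card C = 2 ^ n"
proof -
  define q where "q = n div 2"
  have "odd (n + 1)" "prime q" "prime (n + 1)"
    using assms(2) by (auto simp: safe_prime_def q_def)
  \<comment> \<open>As \<open>n + 1\<close> is odd, the rounded division defining \<open>q\<close>
    is exact.\<close>
  then have n: "n = 2 * q" and p: "prime (Suc (2 * q))" by (auto simp: q_def)
  have m: "m \<le> q" using assms(4) n by linarith
  have "\<exists>F :: nat \<Rightarrow> 'n \<Rightarrow> 'm \<Rightarrow> int. clique_mod l (2 ^ CARD('n)) F" if "prime l" for l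
    using that m n assms(5,6) by (intro clique_mod_prime_exists[OF \<open>prime q\<close> p]) auto
  moreover have "2 * CARD('m) \<le> CARD('n)" using m n assms(5,6) by simp
  ultimately have "\<exists>A :: nat \<Rightarrow> int ^ 'm ^ 'n. \<forall>x<2 ^ CARD('n). \<forall>y<2 ^ CARD('n). x \<noteq> y \<longrightarrow>
      (\<exists>E :: int ^ 'n ^ 'm. E ** (A x - A y) = mat 1)"
    by (intro integral_clique_of_local)
  then obtain A :: "nat \<Rightarrow> int ^ 'm ^ 'n" where A:
    "\<And>x y. x < 2 ^ CARD('n) \<Longrightarrow> y < 2 ^ CARD('n) \<Longrightarrow> x \<noteq> y \<Longrightarrow>
      \<exists>E :: int ^ 'n ^ 'm. E ** (A x - A y) = mat 1"
    by blast
  show ?thesis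
    using exceptional_clique_of_matrices[of "2 ^ CARD('n)" A, OF A] assms(6) by auto
qed

end
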